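(* Let $f$ be an expanding Lorenz map and let $\hat f$ be its extension to the Cantor set $\mathbb{X}$. Let $1<\kappa<\infty$ be the smallest period of the periodic points of $\hat f$. Suppose $O$ is a $\kappa$-periodic orbit of $\hat f$. The following assertions hold. (1) The set $D_O=\overline{\bigcup_{n\ge0}\hat f^{-n}(O)}$ is forward invariant (i.e. $\hat f(D_O)\subset D_O$) and satisfies $\hat f^{-1}(D_O)\setminus D_O\subset\{0,1\}$. (2) $O$ is the unique $\kappa$-periodic orbit of $\hat f$.
   Context: **Expanding Lorenz map.** A map $f\colon[0,1]\to[0,1]$ such that: (i) there is a critical point $c\in(0,1)$ such that $f$ is continuous and strictly increasing on $[0,c)$ and on $(c,1]$; (ii) $\lim_{x\to c^-}f(x)=1$ and $\lim_{x\to c^+}f(x)=0$; (iii) $f$ is differentiable outside a finite set $F\subseteq[0,1]$ and $\inf_{x\notin F}f'(x)>1$. The value $f(c)$ is taken to be $0$ or $1$ (either choice). **Doubled space.** Let $A=\left(\bigcup_{n\ge0}f^{-n}(c)\right)\setminus\{0,1\}$. The space $\mathbb{X}$ is obtained from $[0,1]$ by replacing each $a\in A$ by two points $a_-<a_+$, with the induced linear order and the order topology; it is a Cantor set. The continuous map $\hat f\colon\mathbb{X}\to\mathbb{X}$ is given by: $\hat f(c_-)=1$, $\hat f(c_+)=0$; $\hat f(a_\pm)=f(a)_\pm$ for $a\in A\setminus\{c\}$; $\hat f(x)=f(x)$ for $x\in[0,1]\setminus(A\cup\{0,1\})$; $\hat f(0)=f(0)_+$ if $f(0)\in A$ and $\hat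 f(0)=f(0)$ otherwise; $\hat f(1)=f(1)_-$ if $f(1)\in A$ and $\hat f(1)=f(1)$ otherwise. *)

theory Defs
  imports "HOL-Analysis.Analysis" "HOL-Combinatorics.Combinatorics"
begin

section \<open>Expanding Lorenz maps\<close>

text \<open>
  A map of the unit interval is a total function on the reals of which only the values on
  \<open>{0..1}\<close> matter. At the endpoints \<open>0\<close> and \<open>1\<close> differentiability is one-sided. The infimum
  is taken in the extended reals, where it is meaningful without a boundedness assumption.
\<close>

definition expanding_Lorenz_map :: "(real \<Rightarrow> real) \<Rightarrow> real \<Rightarrow> bool" where
  "expanding_Lorenz_map f c \<longleftrightarrow>
     f ` {0..1} \<subseteq> {0..1} \<and>
     0 < c \<and> c < 1 \<and>
     continuous_on {0..<c} f \<and> strict_mono_on {0..<c} f \<and>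
     continuous_on {c<..1} f \<and> strict_mono_on {c<..1} f \<and>
     (f \<longlongrightarrow> 1) (at_left c) \<and> (f \<longlongrightarrow> 0) (at_right c) \<and>
     f c \<in> {0, 1} \<and>
     (\<exists>F f'. finite F \<and> F \<subseteq> {0..1} \<and>
        (\<forall>x\<in>{0..1} - F. (f has_real_derivative f' x) (at x within {0..1})) \<and>
        (INF x\<in>{0..1} - F. ereal (f' x)) > 1)"

definition preimages_crit :: "(real \<Rightarrow> real) \<Rightarrow> real \<Rightarrow> real set" where
  "preimages_crit f c = (\<Union>n. {x \<in> {0..1}. (f ^^ n) x = c}) - {0, 1}"

section \<open>The doubled space\<close>

text \<open>
  \<open>Pt x\<close> is an undoubled point \<open>x\<close>, and \<open>Lft a < Rgt a\<close> are the two points \<open>a\<^sub>- < a\<^sub>+\<close>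
  replacing \<open>a\<close>. In the order on the whole type \<open>Pt a\<close> is placed between \<open>Lft a\<close> and \<open>Rgt a\<close>;
  this is immaterial, since \<open>doubled_space\<close> never contains \<open>Pt a\<close> together with \<open>Lft a\<close> or \<open>Rgt a\<close>.
\<close>

datatype dpoint = Lft real | Pt real | Rgt real

fun base :: "dpoint \<Rightarrow> real" where
  "base (Lft x) = x"
| "base (Pt x) = x"
| "base (Rgt x) = x"

fun side :: "dpoint \<Rightarrow> int" where
  "side (Lft x) = -1"
| "side (Pt x) = 0"
| "side (Rgt x) = 1"

instantiation dpoint :: linorder
begin

definition less_dpoint :: "dpoint \<Rightarrow> dpoint \<Rightarrow> bool" where
  "p < q \<longleftrightarrow> base p < base q \<or> base p = base q \<and> side p < side q"

definition less_eq_dpoint :: "dpoint \<Rightarrow> dpoint \<Rightarrow> bool" where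
  "p \<le> q \<longleftrightarrow> p < q \<or> p = q" for p q :: dpoint

instance
proof
  have eq: "p = q" if "base p = base q" "side p = side q" for p q
    using that by (cases p; cases q) auto
  fix p q r :: dpoint
  show "p < q \<longleftrightarrow> p \<le> q \<and> \<not> q \<le> p" "p \<le> p"
    "p \<le> q \<Longrightarrow> q \<le> r \<Longrightarrow> p \<le> r" "p \<le> q \<Longrightarrow> q \<le> p \<Longrightarrow> p = q"
    by (auto simp: less_eq_dpoint_def less_dpoint_def)
  show "p \<le> q \<or> q \<le> p"
    using eq[of p q] unfolding less_eq_dpoint_def less_dpoint_def by linarith
qed

end

definition doubled_space :: "(real \<Rightarrow> real) \<Rightarrow> real \<Rightarrow> dpoint set" where
  "doubled_space f c =
     Pt ` ({0..1} - preimages_crit f c) \<union> Lft ` preimages_crit f c \<union> Rgt ` preimages_crit f c"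

text \<open>
  The order topology of the ordered set \<open>X\<close> with its induced order, generated by the open rays
  with endpoint in \<open>X\<close>. (In general it is coarser than the subspace topology induced from an ambient order topology.)
\<close>

definition order_topology_on :: "'a::linorder set \<Rightarrow> 'a topology" where
  "order_topology_on X = topology_generated_by
     (insert X ((\<lambda>p. {x \<in> X. x < p}) ` X \<union> (\<lambda>p. {x \<in> X. p < x}) ` X))"

lemma topspace_order_topology_on: "topspace (order_topology_on X) = X"
  unfolding order_topology_on_def topology_generated_by_topspace by auto

fun Lorenz_ext :: "(real \<Rightarrow> real) \<Rightarrow> real \<Rightarrow> dpoint \<Rightarrow> dpoint" where
  "Lorenz_ext f c (Lft a) = (if a = c then Pt 1 else Lft (f a))"
| "Lorenz_ext f c (Rgt a) = (if a = c then Pt 0 else Rgt (f a))"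
| "Lorenz_ext f c (Pt x) =
     (if x = 0 \<and> f 0 \<in> preimages_crit f c then Rgt (f 0)
      else if x = 1 \<and> f 1 \<in> preimages_crit f c then Lft (f 1)
      else Pt (f x))"

section \<open>Periodic orbits\<close>

text \<open>
  \<open>least_power g x\<close> is the least \<open>n > 0\<close> with \<open>(g ^^ n) x = x\<close>, i.e. the period of the periodic
  point \<open>x\<close>. The smallest period is \<open>\<infinity>\<close> if there are no periodic points.
\<close>

definition periodic_points :: "'a set \<Rightarrow> ('a \<Rightarrow> 'a) \<Rightarrow> 'a set" where
  "periodic_points X g = {x \<in> X. \<exists>n>0. (g ^^ n) x = x}"

definition smallest_period :: "'a set \<Rightarrow> ('a \<Rightarrow> 'a) \<Rightarrow> enat" where
  "smallest_period X g = (INF x\<in>periodic_points X g. enat (least_power g x))"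

definition periodic_orbit :: "'a set \<Rightarrow> ('a \<Rightarrow> 'a) \<Rightarrow> nat \<Rightarrow> 'a set \<Rightarrow> bool" where
  "periodic_orbit X g k Orb \<longleftrightarrow>
     (\<exists>x\<in>periodic_points X g. least_power g x = k \<and> Orb = orbit g x)"

definition backward_closure :: "(real \<Rightarrow> real) \<Rightarrow> real \<Rightarrow> dpoint set \<Rightarrow> dpoint set" where
  "backward_closure f c Orb = order_topology_on (doubled_space f c) closure_of
     (\<Union>n. {x \<in> doubled_space f c. (Lorenz_ext f c ^^ n) x \<in> Orb})"

end

(*
  On each branch the extended map is an increasing bijection onto an order interval, so away from
  the two endpoints it is open as well as continuous. A set that is forward and backward invariant
  therefore has a forward invariant closure, whose preimages can leave it only at the endpoints.

  For uniqueness, let p be the largest point of a periodic orbit of minimal period k to the left of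
  the critical gap. If the image of [p, c_-] under an iterate i < k straddled the gap, it would
  cover [p, c_-] and give a point of period less than k. Hence all points of [p, c_-] have the same
  itinerary up to time k, and by expansivity p is the only point of [p, c_-] fixed by the k-th
  iterate. Two orbits of period k thus have the same largest left point.
*)

theory Submission
  imports Defs
begin

section \<open>The order topology\<close>

lemma openin_order_topology_on_ray:
  assumes "a \<in> X"
  shows "openin (order_topology_on X) {x \<in> X. x < a}"
    and "openin (order_topology_on X) {x \<in> X. a < x}"
  unfolding order_topology_on_def
  by (rule topology_generated_by_Basis; use assms in auto)+

text \<open>Rays form only a subbasis, so the interval is found by induction over the generation of
  \<open>U\<close>. The bounds \<open>a\<close> and \<open>b\<close> are carried along so that it
  can be kept within a branch and at most one step across the gap.\<close>

lemma order_topology_on_nbhd_interval: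
  fixes a b x :: "'a::linorder"
  assumes "openin (order_topology_on X) U" "x \<in> U" "a \<in> X" "b \<in> X" "a < x" "x < b"
  shows "\<exists>p\<in>X. \<exists>q\<in>X. a \<le> p \<and> p < x \<and> x < q \<and> q \<le> b \<and> {y \<in> X. p < y \<and> y < q} \<subseteq> U"
proof -
  have "generate_topology_on (insert X ((\<lambda>p. {x \<in> X. x < p}) ` X \<union> (\<lambda>p. {x \<in> X. p < x}) ` X)) U"
    using assms(1) unfolding order_topology_on_def openin_topology_generated_by_iff .
  then show ?thesis
    using \<open>x \<in> U\<close>
  proof induction
    case Empty
    then show ?case by simp
  next
    case (Int U V)
    then obtain p q p' q' where
      "p \<in> X" "q \<in> X" "a \<le> p" "p < x" "x < q" "q \<le> b" "{y \<in> X. p < y \<and> y < q} \<subseteq> U"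
      "p' \<in> X" "q' \<in> X" "a \<le> p'" "p' < x" "x < q'" "q' \<le> b" "{y \<in> X. p' < y \<and> y < q'} \<subseteq> V"
      by auto
    then show ?case
      by (intro bexI[of _ "max p p'"] bexI[of _ "min q q'"]) (auto simp: max_def min_def)
  next
    case (UN K)
    then obtain k where k: "k \<in> K" "x \<in> k" by blast
    from UN.IH[OF k] obtain p q where "p \<in> X" "q \<in> X" "a \<le> p" "p < x" "x < q" "q \<le> b"
      "{y \<in> X. p < y \<and> y < q} \<subseteq> k"
      by blast
    then show ?case
      using k(1) by (intro bexI[of _ p] bexI[of _ q]) auto
  next
    case (Basis s)
    then consider "s = X" | r where "r \<in> X" "s = {x \<in> X. x < r}"
      | r where "r \<in> X" "s = {x \<in> X. r < x}"
      by blast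
    then show ?case
    proof cases
      case 1
      then show ?thesis
        using assms by (intro bexI[of _ a] bexI[of _ b]) auto
    next
      case (2 r)
      then show ?thesis
        using assms Basis by (intro bexI[of _ a] bexI[of _ "min b r"]) (auto simp: min_def)
    next
      case (3 r)
      then show ?thesis
        using assms Basis by (intro bexI[of _ "max a r"] bexI[of _ b]) (auto simp: max_def)
    qed
  qed
qed

section \<open>Lorenz maps of ordered sets\<close>

text \<open>Collects in terms of order alone what the argument uses of the doubled space:
  \<open>m\<close> and \<open>M\<close> are the ends, \<open>cl\<close> and \<open>cr\<close> bound
  the gap, and \<open>expansive\<close> says that an itinerary determines its point. The image
  conditions force \<open>g cl = M\<close> and \<open>g cr = m\<close>.\<close>

locale order_Lorenz =
  fixes X :: "'a::linorder set" and g :: "'a \<Rightarrow> 'a" and m M cl cr :: 'a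
  assumes mem: "m \<in> X" "M \<in> X" "cl \<in> X" "cr \<in> X"
    and bounds: "x \<in> X \<Longrightarrow> m \<le> x" "x \<in> X \<Longrightarrow> x \<le> M"
    and jump: "cl < cr" "x \<in> X \<Longrightarrow> x \<le> cl \<or> cr \<le> x"
    and mono_left: "\<lbrakk>x \<in> X; y \<in> X; x < y; y \<le> cl\<rbrakk> \<Longrightarrow> g x < g y"
    and mono_right: "\<lbrakk>x \<in> X; y \<in> X; x < y; cr \<le> x\<rbrakk> \<Longrightarrow> g x < g y"
    and image_left: "g ` {x \<in> X. x \<le> cl} = {y \<in> X. g m \<le> y}"
    and image_right: "g ` {x \<in> X. cr \<le> x} = {y \<in> X. y \<le> g M}"
    and complete: "\<lbrakk>S \<subseteq> X; S \<noteq> {}\<rbrakk> \<Longrightarrow>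
        \<exists>s\<in>X. (\<forall>t\<in>S. t \<le> s) \<and> (\<forall>u\<in>X. (\<forall>t\<in>S. t \<le> u) \<longrightarrow> s \<le> u)"
    and expansive: "\<lbrakk>x \<in> X; y \<in> X; \<And>n. (g ^^ n) x \<le> cl \<longleftrightarrow> (g ^^ n) y \<le> cl\<rbrakk> \<Longrightarrow> x = y"
begin

lemma g_mem: "x \<in> X \<Longrightarrow> g x \<in> X"
  using jump(2)[of x] image_left image_right by blast

lemma funpow_mem: "x \<in> X \<Longrightarrow> (g ^^ n) x \<in> X"
  by (induction n) (auto intro: g_mem)

lemma mono_left_le: "\<lbrakk>x \<in> X; y \<in> X; x \<le> y; y \<le> cl\<rbrakk> \<Longrightarrow> g x \<le> g y"
  using mono_left by (metis order.order_iff_strict)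

lemma mono_right_le: "\<lbrakk>x \<in> X; y \<in> X; x \<le> y; cr \<le> x\<rbrakk> \<Longrightarrow> g x \<le> g y"
  using mono_right by (metis order.order_iff_strict)

lemma less_left_iff: "\<lbrakk>x \<in> X; y \<in> X; x \<le> cl; y \<le> cl\<rbrakk> \<Longrightarrow> g x < g y \<longleftrightarrow> x < y"
  using mono_left by (meson linorder_not_le mono_left_le)

lemma less_right_iff: "\<lbrakk>x \<in> X; y \<in> X; cr \<le> x; cr \<le> y\<rbrakk> \<Longrightarrow> g x < g y \<longleftrightarrow> x < y"
  using mono_right by (meson linorder_not_le mono_right_le)

text \<open>Serves to pull back rays along the branch: if the endpoint is a value of the branch, the
  preimage is a ray at its preimage; otherwise it is empty or the whole branch.\<close>

lemma mem_left_cases: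
  assumes "p \<in> X"
  obtains "p < g m" | z where "z \<in> X" "z \<le> cl" "p = g z"
  using assms image_left by (force simp: not_le[symmetric])

lemma mem_right_cases:
  assumes "p \<in> X"
  obtains "g M < p" | z where "z \<in> X" "cr \<le> z" "p = g z"
  using assms image_right by (force simp: not_le[symmetric])

section \<open>Continuity of the map in the order topology\<close>

abbreviation "T \<equiv> order_topology_on X"

lemma open_below: "a \<in> X \<Longrightarrow> openin T {x \<in> X. x < a}"
  and open_above: "a \<in> X \<Longrightarrow> openin T {x \<in> X. a < x}"
  by (fact openin_order_topology_on_ray)+

lemma g_M_max: "x \<in> X \<Longrightarrow> cr \<le> x \<Longrightarrow> g x \<le> g M"
  using mono_right_le bounds mem by blast

lemma g_m_min: "x \<in> X \<Longrightarrow> x \<le> cl \<Longrightarrow> g m \<le> g x"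
  using mono_left_le bounds mem by blast

text \<open>No point of \<open>X\<close> lies in the gap, so the closed ray ending at
  \<open>cl\<close> is the open ray ending at \<open>cr\<close>.\<close>

lemma left_open: "openin T {x \<in> X. x \<le> cl}"
proof -
  have "{x \<in> X. x \<le> cl} = {x \<in> X. x < cr}"
    using jump by force
  then show ?thesis
    using open_below[OF mem(4)] by simp
qed

lemma right_open: "openin T {x \<in> X. cr \<le> x}"
proof -
  have "{x \<in> X. cr \<le> x} = {x \<in> X. cl < x}"
    using jump by force
  then show ?thesis
    using open_above[OF mem(3)] by simp
qed

lemma open_X: "openin T X"
  using openin_topspace[of T] by (simp add: topspace_order_topology_on)

lemma open_preimage_split:
  assumes "openin T U" "openin T V"
    and "{x \<in> X. x \<le> cl \<and> P x} = {x \<in> X. x \<le> cl} \<inter> U"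
    and "{x \<in> X. cr \<le> x \<and> P x} = {x \<in> X. cr \<le> x} \<inter> V"
  shows "openin T {x \<in> X. P x}"
proof -
  have "{x \<in> X. P x} = {x \<in> X. x \<le> cl \<and> P x} \<union> {x \<in> X. cr \<le> x \<and> P x}"
    using jump by auto
  then show ?thesis
    unfolding assms(3,4) using left_open right_open assms(1,2) by auto
qed

text \<open>On each branch the preimage is cut out by the ray at the preimage of \<open>p\<close>.
  If \<open>p\<close> is not a value of the branch, the preimage is empty on the left branch and
  everything on the right one.\<close>

lemma open_preimage_below:
  assumes "p \<in> X"
  shows "openin T {x \<in> X. g x < p}"
proof -
  have "\<exists>U. openin T U \<and> {x \<in> X. x \<le> cl \<and> g x < p} = {x \<in> X. x \<le> cl} \<inter> U"
  proof (cases rule: mem_left_cases[OF assms])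
    case 1
    then show ?thesis
      using g_m_min by (intro exI[of _ "{}"]) fastforce
  next
    case (2 z)
    then show ?thesis
      using less_left_iff open_below open_above
      by (intro exI[of _ "{x \<in> X. x < z}"]) auto
  qed
  moreover have "\<exists>V. openin T V \<and> {x \<in> X. cr \<le> x \<and> g x < p} = {x \<in> X. cr \<le> x} \<inter> V"
  proof (cases rule: mem_right_cases[OF assms])
    case 1
    then show ?thesis
      using g_M_max open_X by (intro exI[of _ X]) fastforce
  next
    case (2 z)
    then show ?thesis
      using less_right_iff open_below open_above
      by (intro exI[of _ "{x \<in> X. x < z}"]) auto
  qed
  ultimately show ?thesis
    by (elim exE conjE) (rule open_preimage_split)
qed

lemma open_preimage_above:
  assumes "p \<in> X"
  shows "openin T {x \<in> X. p < g x}"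
proof -
  have "\<exists>U. openin T U \<and> {x \<in> X. x \<le> cl \<and> p < g x} = {x \<in> X. x \<le> cl} \<inter> U"
  proof (cases rule: mem_left_cases[OF assms])
    case 1
    then show ?thesis
      using g_m_min open_X by (intro exI[of _ X]) fastforce
  next
    case (2 z)
    then show ?thesis
      using less_left_iff open_below open_above
      by (intro exI[of _ "{x \<in> X. z < x}"]) auto
  qed
  moreover have "\<exists>V. openin T V \<and> {x \<in> X. cr \<le> x \<and> p < g x} = {x \<in> X. cr \<le> x} \<inter> V"
  proof (cases rule: mem_right_cases[OF assms])
    case 1
    then show ?thesis
      using g_M_max by (intro exI[of _ "{}"]) fastforce
  next
    case (2 z)
    then show ?thesis
      using less_right_iff open_below open_above
      by (intro exI[of _ "{x \<in> X. z < x}"]) auto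
  qed
  ultimately show ?thesis
    by (elim exE conjE) (rule open_preimage_split)
qed

lemma continuous_map_g: "continuous_map T T g"
proof -
  have "openin T (g -` U \<inter> X)"
    if U: "U \<in> insert X ((\<lambda>p. {x \<in> X. x < p}) ` X \<union> (\<lambda>p. {x \<in> X. p < x}) ` X)" for U
  proof -
    consider "U = X" | p where "p \<in> X" "U = {x \<in> X. x < p}" | p where "p \<in> X" "U = {x \<in> X. p < x}"
      using U by blast
    then show ?thesis
    proof cases
      case 1
      then have "g -` U \<inter> X = X" using g_mem by auto
      then show ?thesis using open_X by simp
    next
      case (2 p)
      then have "g -` U \<inter> X = {x \<in> X. g x < p}" using g_mem by auto
      then show ?thesis using open_preimage_below 2 by simp
    next
      case (3 p)
      then have "g -` U \<inter> X = {x \<in> X. p < g x}" using g_mem by auto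
      then show ?thesis using open_preimage_above 3 by simp
    qed
  qed
  then have "continuous_map T (topology_generated_by
     (insert X ((\<lambda>p. {x \<in> X. x < p}) ` X \<union> (\<lambda>p. {x \<in> X. p < x}) ` X))) g"
    by (intro continuous_on_generated_topo)
      (auto simp: topspace_order_topology_on g_mem)
  then show ?thesis
    unfolding order_topology_on_def .
qed

section \<open>Closures of invariant sets\<close>

lemma closure_forward_invariant:
  assumes "g ` S \<subseteq> S"
  shows "g ` (T closure_of S) \<subseteq> T closure_of S"
  using continuous_map_image_closure_subset[OF continuous_map_g] closure_of_mono[OF assms]
  by blast

text \<open>Away from the two endpoints, \<open>g\<close> is open: an interval around \<open>x\<close> inside a branch is mapped
  onto a neighbourhood of \<open>g x\<close>.\<close>

lemma closure_backward_left:
  assumes S: "\<And>x. x \<in> X \<Longrightarrow> g x \<in> S \<Longrightarrow> x \<in> S"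
    and x: "x \<in> X" "m < x" "x \<le> cl" "g x \<in> T closure_of S"
  shows "x \<in> T closure_of S"
  unfolding in_closure_of topspace_order_topology_on
proof (intro conjI allI impI)
  fix U assume "x \<in> U \<and> openin T U"
  then obtain p q where pq: "p \<in> X" "q \<in> X" "m \<le> p" "p < x" "x < q" "q \<le> cr"
    "{y \<in> X. p < y \<and> y < q} \<subseteq> U"
    using order_topology_on_nbhd_interval[of X U x m cr] x mem jump(1) by fastforce
  \<comment> \<open>If \<open>q\<close> is not in the left branch, then \<open>q = cr\<close> and
    the interval reaches up to \<open>cl\<close>, whose image is \<open>M\<close>; no upper bound is
    then imposed on \<open>V\<close>.\<close>
  define V where "V = (if q \<le> cl then {y \<in> X. g p < y} \<inter> {y \<in> X. y < g q} else {y \<in> X. g p < y})"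
  have "openin T V"
    unfolding V_def using open_below open_above g_mem pq by auto
  moreover have "g x \<in> V"
    unfolding V_def using pq x mono_left g_mem by auto
  ultimately obtain y where y: "y \<in> S" "y \<in> V"
    using x(4) unfolding in_closure_of by blast
  then have "y \<in> X" "g p < y"
    by (auto simp: V_def split: if_splits)
  moreover have "g m \<le> g p"
    using pq x g_m_min by simp
  ultimately obtain z where z: "z \<in> X" "z \<le> cl" "y = g z"
    using mem_left_cases[of y] by (metis le_less_trans not_less_iff_gr_or_eq)
  have "p < z"
    using \<open>g p < y\<close> z less_left_iff pq x by auto
  moreover have "z < q"
    using y(2) z less_left_iff pq by (cases "q \<le> cl") (auto simp: V_def)
  ultimately have "z \<in> U"
    using pq z by blast
  then show "\<exists>y. y \<in> S \<and> y \<in> U"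
    using S z y by blast
qed (use x in simp)

lemma closure_backward_right:
  assumes S: "\<And>x. x \<in> X \<Longrightarrow> g x \<in> S \<Longrightarrow> x \<in> S"
    and x: "x \<in> X" "x < M" "cr \<le> x" "g x \<in> T closure_of S"
  shows "x \<in> T closure_of S"
  unfolding in_closure_of topspace_order_topology_on
proof (intro conjI allI impI)
  fix U assume "x \<in> U \<and> openin T U"
  then obtain p q where pq: "p \<in> X" "q \<in> X" "cl \<le> p" "p < x" "x < q" "q \<le> M"
    "{y \<in> X. p < y \<and> y < q} \<subseteq> U"
    using order_topology_on_nbhd_interval[of X U x cl M] x mem jump(1) by fastforce
  \<comment> \<open>Here the exceptional case is \<open>p = cl\<close>: the interval reaches down to
    \<open>cr\<close>, whose image is \<open>m\<close>.\<close>
  define V where "V = (if cr \<le> p then {y \<in> X. g p < y} \<inter> {y \<in> X. y < g q} else {y \<in> X. y < g q})"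
  have "openin T V"
    unfolding V_def using open_below open_above g_mem pq by auto
  moreover have "g x \<in> V"
    unfolding V_def using pq x mono_right g_mem by auto
  ultimately obtain y where y: "y \<in> S" "y \<in> V"
    using x(4) unfolding in_closure_of by blast
  then have "y \<in> X" "y < g q"
    by (auto simp: V_def split: if_splits)
  moreover have "g q \<le> g M"
    using pq x g_M_max by simp
  ultimately obtain z where z: "z \<in> X" "cr \<le> z" "y = g z"
    using mem_right_cases[of y] by (metis less_le_trans not_less_iff_gr_or_eq)
  have "z < q"
    using \<open>y < g q\<close> z less_right_iff pq x by auto
  moreover have "p < z"
    using y(2) z less_right_iff pq by (cases "cr \<le> p") (auto simp: V_def)
  ultimately have "z \<in> U"
    using pq z by blast
  then show "\<exists>y. y \<in> S \<and> y \<in> U"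
    using S z y by blast
qed (use x in simp)

text \<open>The ends are exceptional because small neighbourhoods of \<open>m\<close> are mapped to
  one side of \<open>g m\<close> only, and points of \<open>S\<close> may accumulate at
  \<open>g m\<close> from the other side; likewise for \<open>M\<close>.\<close>

lemma closure_backward_invariant:
  assumes "\<And>x. x \<in> X \<Longrightarrow> g x \<in> S \<Longrightarrow> x \<in> S"
  shows "{x \<in> X. g x \<in> T closure_of S} - T closure_of S \<subseteq> {m, M}"
proof -
  have "x \<in> T closure_of S" if "x \<in> X" "g x \<in> T closure_of S" "x \<noteq> m" "x \<noteq> M" for x
    using closure_backward_left[OF assms that(1)] closure_backward_right[OF assms that(1)]
      that jump(2)[of x] bounds[of x] by (auto simp: less_le)
  then show ?thesis
    by blast
qed

subsection \<open>Periodic orbits\<close>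

text \<open>Completeness replaces the intermediate value theorem. Let \<open>s\<close> be the
  supremum of the points with \<open>h x \<le> x\<close>, and \<open>s = h z\<close>. If
  \<open>z < s\<close>, some such \<open>t\<close> exceeds \<open>z\<close>, and
  \<open>s = h z < h t \<le> t \<le> s\<close>; if \<open>s < z\<close>, then \<open>z\<close> is
  itself such a point above \<open>s\<close>.\<close>

lemma fixed_point_of_covering:
  assumes ab: "a \<in> X" "b \<in> X" "a \<le> b" "h a \<le> a"
    and mono: "\<And>x y. \<lbrakk>x \<in> X; y \<in> X; a \<le> x; x < y; y \<le> b\<rbrakk> \<Longrightarrow> h x < h y"
    and cover: "{x \<in> X. a \<le> x \<and> x \<le> b} \<subseteq> h ` {x \<in> X. a \<le> x \<and> x \<le> b}"
  shows "\<exists>z\<in>X. a \<le> z \<and> z \<le> b \<and> h z = z"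
proof -
  define S where "S = {x \<in> X. a \<le> x \<and> x \<le> b \<and> h x \<le> x}"
  have "a \<in> S" "S \<subseteq> X"
    using ab by (auto simp: S_def)
  then obtain s where s: "s \<in> X" "\<And>t. t \<in> S \<Longrightarrow> t \<le> s" "\<And>u. u \<in> X \<Longrightarrow> (\<And>t. t \<in> S \<Longrightarrow> t \<le> u) \<Longrightarrow> s \<le> u"
    using complete[OF \<open>S \<subseteq> X\<close>] by blast
  have "a \<le> s" "s \<le> b"
    using s \<open>a \<in> S\<close> ab(2) by (auto simp: S_def)
  then obtain z where z: "z \<in> X" "a \<le> z" "z \<le> b" "s = h z"
    using cover s(1) by blast
  have "\<not> z < s"
  proof
    assume "z < s"
    then obtain t where t: "t \<in> S" "z < t"
      using s(3)[OF z(1)] by (meson not_le)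
    then have "h z < h t"
      using mono z by (auto simp: S_def)
    then show False
      using t s(2)[of t] z(4) by (auto simp: S_def)
  qed
  moreover have "\<not> s < z"
  proof
    assume "s < z"
    then have "z \<in> S"
      using z by (auto simp: S_def)
    then show False
      using s(2) \<open>s < z\<close> by (simp add: not_less[symmetric])
  qed
  ultimately show ?thesis
    using z by (intro bexI[of _ z]) auto
qed

text \<open>A value between \<open>g u\<close> and \<open>g v\<close> lies in the image of the
  branch, and strict monotonicity places its preimage between \<open>u\<close> and
  \<open>v\<close>.\<close>

lemma image_interval:
  assumes "u \<in> X" "v \<in> X" "u \<le> v" "v \<le> cl \<or> cr \<le> u"
  shows "{y \<in> X. g u \<le> y \<and> y \<le> g v} \<subseteq> g ` {x \<in> X. u \<le> x \<and> x \<le> v}"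
proof
  fix y assume y: "y \<in> {y \<in> X. g u \<le> y \<and> y \<le> g v}"
  show "y \<in> g ` {x \<in> X. u \<le> x \<and> x \<le> v}"
  proof (cases "v \<le> cl")
    case True
    then have "g m \<le> y"
      using y g_m_min[of u] True assms by (auto intro: order_trans)
    then have "y \<in> g ` {x \<in> X. x \<le> cl}"
      using y by (simp add: image_left)
    then obtain z where "z \<in> X" "z \<le> cl" "y = g z"
      by blast
    then show ?thesis
      using y less_left_iff[of z u] less_left_iff[of v z] True assms
      by (intro image_eqI[of _ _ z]) (auto simp: not_less[symmetric])
  next
    case False
    then have "y \<le> g M"
      using y g_M_max[of v] False assms by (auto intro: order_trans)
    then have "y \<in> g ` {x \<in> X. cr \<le> x}"
      using y by (simp add: image_right)
    then obtain z where "z \<in> X" "cr \<le> z" "y = g z"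
      by blast
    then show ?thesis
      using y less_right_iff[of z u] less_right_iff[of v z] False assms
      by (intro image_eqI[of _ _ z]) (auto simp: not_less[symmetric])
  qed
qed

text \<open>Induction on \<open>i\<close>: by monotonicity of the previous iterate the image of
  \<open>[u, v]\<close> lies between the images of its ends, hence in a single branch, and
  \<open>image_interval\<close> carries the covering one step further. No side condition is imposed
  at time \<open>i\<close> itself.\<close>

lemma funpow_on_interval:
  assumes "u \<in> X" "v \<in> X" "u \<le> v"
    and "\<And>j. j < i \<Longrightarrow> (g ^^ j) v \<le> cl \<or> cr \<le> (g ^^ j) u"
  shows "\<And>x y. \<lbrakk>x \<in> X; y \<in> X; u \<le> x; x < y; y \<le> v\<rbrakk> \<Longrightarrow> (g ^^ i) x < (g ^^ i) y"
    and "{y \<in> X. (g ^^ i) u \<le> y \<and> y \<le> (g ^^ i) v} \<subseteq> (g ^^ i) ` {x \<in> X. u \<le> x \<and> x \<le> v}"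
proof -
  have *: "(\<forall>x\<in>X. \<forall>y\<in>X. u \<le> x \<longrightarrow> x < y \<longrightarrow> y \<le> v \<longrightarrow> (g ^^ i) x < (g ^^ i) y) \<and>
    {y \<in> X. (g ^^ i) u \<le> y \<and> y \<le> (g ^^ i) v} \<subseteq> (g ^^ i) ` {x \<in> X. u \<le> x \<and> x \<le> v}"
    using assms(4)
  proof (induction i)
    case 0
    then show ?case by auto
  next
    case (Suc i)
    then have mono: "\<And>x y. \<lbrakk>x \<in> X; y \<in> X; u \<le> x; x < y; y \<le> v\<rbrakk> \<Longrightarrow> (g ^^ i) x < (g ^^ i) y"
      and cover: "{y \<in> X. (g ^^ i) u \<le> y \<and> y \<le> (g ^^ i) v} \<subseteq> (g ^^ i) ` {x \<in> X. u \<le> x \<and> x \<le> v}"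
      by auto
    have mono_le: "(g ^^ i) x \<le> (g ^^ i) y" if "x \<in> X" "y \<in> X" "u \<le> x" "x \<le> y" "y \<le> v" for x y
      using mono[of x y] that by (metis order.order_iff_strict)
    have side: "(g ^^ i) v \<le> cl \<or> cr \<le> (g ^^ i) u"
      using Suc.prems by simp
    have "(g ^^ Suc i) x < (g ^^ Suc i) y" if "x \<in> X" "y \<in> X" "u \<le> x" "x < y" "y \<le> v" for x y
    proof -
      have "(g ^^ i) u \<le> (g ^^ i) x" "(g ^^ i) y \<le> (g ^^ i) v" "(g ^^ i) x < (g ^^ i) y"
        using mono_le mono that assms by auto
      moreover from this have "(g ^^ i) y \<le> cl \<or> cr \<le> (g ^^ i) x"
        using side order_trans by blast
      ultimately show ?thesis
        using mono_left mono_right funpow_mem that(1,2) by auto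
    qed
    moreover have "{y \<in> X. (g ^^ Suc i) u \<le> y \<and> y \<le> (g ^^ Suc i) v}
        \<subseteq> (g ^^ Suc i) ` {x \<in> X. u \<le> x \<and> x \<le> v}"
    proof -
      have "{y \<in> X. (g ^^ Suc i) u \<le> y \<and> y \<le> (g ^^ Suc i) v}
          \<subseteq> g ` {y \<in> X. (g ^^ i) u \<le> y \<and> y \<le> (g ^^ i) v}"
        using image_interval[OF _ _ _ side] funpow_mem mono_le assms by auto
      also have "\<dots> \<subseteq> g ` (g ^^ i) ` {x \<in> X. u \<le> x \<and> x \<le> v}"
        using cover by blast
      finally show ?thesis
        by (simp add: image_image)
    qed
    ultimately show ?case
      by blast
  qed
  show "(g ^^ i) x < (g ^^ i) y" if "x \<in> X" "y \<in> X" "u \<le> x" "x < y" "y \<le> v" for x y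
    using *[THEN conjunct1] that by simp
  show "{y \<in> X. (g ^^ i) u \<le> y \<and> y \<le> (g ^^ i) v} \<subseteq> (g ^^ i) ` {x \<in> X. u \<le> x \<and> x \<le> v}"
    using * by (rule conjunct2)
qed

text \<open>At the first time \<open>i\<close> at which the image of \<open>[p, cl]\<close> straddles the gap, \<open>g ^^ i\<close> maps
  \<open>[p, cl]\<close> over itself, since the orbit point \<open>(g ^^ i) p \<le> cl\<close> lies to the left of \<open>p\<close>; the
  resulting fixed point of \<open>g ^^ i\<close> is excluded for \<open>i < k\<close>.\<close>

lemma no_straddling:
  assumes p: "p \<in> X" "p \<le> cl" "\<And>j. (g ^^ j) p \<le> cl \<Longrightarrow> (g ^^ j) p \<le> p"
    and no_per: "\<And>z n. \<lbrakk>z \<in> X; 0 < n; n < k\<rbrakk> \<Longrightarrow> (g ^^ n) z \<noteq> z"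
  shows "i < k \<Longrightarrow> (g ^^ i) cl \<le> cl \<or> cr \<le> (g ^^ i) p"
proof (induction i rule: less_induct)
  case (less i)
  show ?case
  proof (rule ccontr)
    assume neg: "\<not> ?thesis"
    then have "(g ^^ i) p \<le> cl" "cr \<le> (g ^^ i) cl"
      using jump(2) funpow_mem p(1) mem(3) by blast+
    \<comment> \<open>At time 0 the image is \<open>[p, cl]\<close> itself, which does not straddle
      the gap.\<close>
    have "i > 0"
      using neg by (cases i) auto
    have prev: "\<And>j. j < i \<Longrightarrow> (g ^^ j) cl \<le> cl \<or> cr \<le> (g ^^ j) p"
      using less by auto
    note interval = funpow_on_interval[where i = i, OF p(1) mem(3) p(2) prev]
    have "(g ^^ i) p \<le> p"
      using \<open>(g ^^ i) p \<le> cl\<close> p(3) by blast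
    then have "{x \<in> X. p \<le> x \<and> x \<le> cl} \<subseteq> (g ^^ i) ` {x \<in> X. p \<le> x \<and> x \<le> cl}"
      using \<open>cr \<le> (g ^^ i) cl\<close> jump(1) by (intro order_trans[OF _ interval(2)]) auto
    then obtain z where "z \<in> X" "(g ^^ i) z = z"
      using fixed_point_of_covering[where h = "g ^^ i", OF p(1) mem(3) p(2) \<open>(g ^^ i) p \<le> p\<close> interval(1)] by blast
    then show False
      using no_per \<open>i > 0\<close> less.prems by blast
  qed
qed

text \<open>Since \<open>q\<close> lies in \<open>[p, cl]\<close>, whose images do not straddle the
  gap before time \<open>k\<close>, the itineraries of \<open>p\<close> and \<open>q\<close> agree
  up to that time. Both points return at time \<open>k\<close>, so they agree forever.\<close>

lemma period_eq:
  assumes p: "p \<in> X" "p \<le> cl" "\<And>j. (g ^^ j) p \<le> cl \<Longrightarrow> (g ^^ j) p \<le> p"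
    and no_per: "\<And>z n. \<lbrakk>z \<in> X; 0 < n; n < k\<rbrakk> \<Longrightarrow> (g ^^ n) z \<noteq> z"
    and "0 < k" "(g ^^ k) p = p"
    and q: "q \<in> X" "p \<le> q" "q \<le> cl" "(g ^^ k) q = q"
  shows "p = q"
proof (rule expansive[OF p(1) q(1)])
  have side: "(g ^^ n) p \<le> cl \<longleftrightarrow> (g ^^ n) q \<le> cl" if "n < k" for n
  proof -
    have prev: "\<And>j. j < n \<Longrightarrow> (g ^^ j) cl \<le> cl \<or> cr \<le> (g ^^ j) p"
      and now: "(g ^^ n) cl \<le> cl \<or> cr \<le> (g ^^ n) p"
      using no_straddling[OF p no_per] that by auto
    note mono = funpow_on_interval(1)[where i = n, OF p(1) mem(3) p(2) prev]
    have "(g ^^ n) p \<le> (g ^^ n) q"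
      using mono[of p q] p(1) q(1-3) by (metis order.order_iff_strict)
    moreover have "(g ^^ n) q \<le> (g ^^ n) cl"
      using mono[of q cl] mem(3) q(1-3) by (metis order.order_iff_strict)
    \<comment> \<open>The iterates of \<open>p\<close>, \<open>q\<close> and \<open>cl\<close> come
      in this order, and by \<open>now\<close> either the last is on the left or the first is on the
      right.\<close>
    ultimately show ?thesis
      using now jump(1) by (auto intro: order_trans)
  qed
  show "(g ^^ n) p \<le> cl \<longleftrightarrow> (g ^^ n) q \<le> cl" for n
    using side[of "n mod k"] \<open>0 < k\<close> funpow_mod_eq[OF assms(6)] funpow_mod_eq[OF q(4)] by simp
qed

text \<open>If the orbit never visited the left branch, \<open>x\<close> and \<open>g x\<close>
  would have the same itinerary and coincide by expansivity. So the finite orbit has points on the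
  left, and one of them is largest.\<close>

lemma orbit_largest_left:
  assumes x: "x \<in> X" "(g ^^ k) x = x" and "0 < k" "g x \<noteq> x"
  shows "\<exists>i. (g ^^ i) x \<le> cl \<and> (\<forall>j. (g ^^ j) x \<le> cl \<longrightarrow> (g ^^ j) x \<le> (g ^^ i) x)"
proof -
  have mod: "(g ^^ n) x = (g ^^ (n mod k)) x" for n
    using funpow_mod_eq[OF x(2)] by simp
  define P where "P = {(g ^^ n) x | n. n < k \<and> (g ^^ n) x \<le> cl}"
  have inP: "(g ^^ n) x \<in> P" if "(g ^^ n) x \<le> cl" for n
    using mod[of n] that \<open>0 < k\<close> unfolding P_def by (intro CollectI exI[of _ "n mod k"]) auto
  have fin: "finite P"
    unfolding P_def by auto
  have "P \<noteq> {}"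
  proof
    assume "P = {}"
    then have "\<not> (g ^^ n) x \<le> cl" for n
      using inP by auto
    then have "g x = x"
      by (intro expansive[OF g_mem[OF x(1)] x(1)]) (metis comp_apply funpow_Suc_right)
    then show False
      using assms(4) by simp
  qed
  then have "Max P \<in> P"
    using fin by simp
  then obtain i where "Max P = (g ^^ i) x" "(g ^^ i) x \<le> cl"
    by (auto simp: P_def)
  then show ?thesis
    using Max_ge[OF fin inP] by (intro exI[of _ i]) auto
qed

text \<open>A return time bounds the period from above, so one below \<open>k\<close> would undercut
  the infimum. Minimality of the period enters the uniqueness argument in this form.\<close>

lemma least_power_ge_smallest_period:
  assumes "smallest_period X g = enat k" "z \<in> X" "0 < n" "n < k"
  shows "(g ^^ n) z \<noteq> z"
proof
  assume "(g ^^ n) z = z"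
  then have "z \<in> periodic_points X g"
    using assms by (auto simp: periodic_points_def)
  then have "enat k \<le> enat (least_power g z)"
    unfolding assms(1)[symmetric] smallest_period_def by (rule INF_lower)
  moreover have "least_power g z \<le> n"
    using least_power_le[of n g z] \<open>(g ^^ n) z = z\<close> assms by simp
  ultimately show False
    using assms(4) by simp
qed

lemma periodic_orbit_leftmost:
  assumes "periodic_orbit X g k Orb" "1 < k"
  obtains p where "p \<in> X" "p \<le> cl" "\<And>j. (g ^^ j) p \<le> cl \<Longrightarrow> (g ^^ j) p \<le> p"
    "(g ^^ k) p = p" "Orb = orbit g p"
proof -
  obtain x where x: "x \<in> X" "least_power g x = k" "Orb = orbit g x" "\<exists>n>0. (g ^^ n) x = x"
    using assms by (auto simp: periodic_orbit_def periodic_points_def)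
  then have k: "(g ^^ k) x = x"
    using least_powerI by metis
  \<comment> \<open>A fixed point has period 1, against \<open>1 < k\<close>.\<close>
  have "g x \<noteq> x"
    using least_power_le[of 1 g x] x(2) assms(2) by auto
  then obtain i where i: "(g ^^ i) x \<le> cl" "\<And>j. (g ^^ j) x \<le> cl \<Longrightarrow> (g ^^ j) x \<le> (g ^^ i) x"
    using orbit_largest_left[OF x(1) k] assms(2) by auto
  \<comment> \<open>\<open>orbit g x\<close> starts at \<open>g x\<close>, so \<open>x\<close>
    belongs to it only because it returns at time \<open>k\<close>.\<close>
  have "x \<in> orbit g x"
    using k assms(2) unfolding orbit_altdef by (auto intro!: exI[of _ k])
  show thesis
  proof
    show "(g ^^ i) x \<in> X"
      using funpow_mem x(1) by blast
    show "(g ^^ j) ((g ^^ i) x) \<le> (g ^^ i) x" if "(g ^^ j) ((g ^^ i) x) \<le> cl" for j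
      using i(2)[of "j + i"] that by (simp add: funpow_add)
    show "(g ^^ k) ((g ^^ i) x) = (g ^^ i) x"
      using k by (metis comp_apply funpow_add add.commute)
    have "(g ^^ i) x \<in> orbit g x" "x \<in> orbit g ((g ^^ i) x)"
      using funpow_in_orbit orbit_swap \<open>x \<in> orbit g x\<close> by fast+
    then show "Orb = orbit g ((g ^^ i) x)"
      unfolding x(3) using orbit_trans by fast
  qed (use i in simp)
qed

theorem unique_periodic_orbit:
  assumes "smallest_period X g = enat k" "1 < k"
    and "periodic_orbit X g k Orb" "periodic_orbit X g k Orb'"
  shows "Orb' = Orb"
proof -
  note no_per = least_power_ge_smallest_period[OF assms(1)]
  obtain p where p: "p \<in> X" "p \<le> cl" "\<And>j. (g ^^ j) p \<le> cl \<Longrightarrow> (g ^^ j) p \<le> p"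
    "(g ^^ k) p = p" "Orb = orbit g p"
    using periodic_orbit_leftmost[OF assms(3,2)] by blast
  obtain q where q: "q \<in> X" "q \<le> cl" "\<And>j. (g ^^ j) q \<le> cl \<Longrightarrow> (g ^^ j) q \<le> q"
    "(g ^^ k) q = q" "Orb' = orbit g q"
    using periodic_orbit_leftmost[OF assms(4,2)] by blast
  \<comment> \<open>Whichever of the two is smaller takes the role of the lower point in
    \<open>period_eq\<close>.\<close>
  have "p = q"
    using period_eq[OF p(1-3) no_per _ p(4) q(1) _ q(2,4)]
      period_eq[OF q(1-3) no_per _ q(4) p(1) _ p(2,4)] assms(2)
    by (metis linorder_le_cases less_trans zero_less_one)
  then show ?thesis
    using p q by simp
qed

end

section \<open>Expanding branches\<close>

text \<open>Integrates the bound on the derivative; the fundamental theorem of calculus used here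
  tolerates a finite exceptional set.\<close>

lemma expanding_of_derivative_ge:
  fixes h h' :: "real \<Rightarrow> real"
  assumes "a \<le> b" "continuous_on {a..b} h" "finite F"
    and "\<And>x. x \<in> {a<..<b} - F \<Longrightarrow> (h has_real_derivative h' x) (at x)"
    and "\<And>x. x \<in> {a<..<b} - F \<Longrightarrow> l \<le> h' x"
  shows "l * (b - a) \<le> h b - h a"
proof -
  \<comment> \<open>The default \<open>l\<close> at the exceptional points keeps
    \<open>l \<le> D x\<close> true on all of \<open>[a, b]\<close>.\<close>
  define D where "D x = (if x \<in> {a<..<b} - F then h' x else l)" for x
  have D: "(D has_integral (h b - h a)) {a..b}"
    by (rule fundamental_theorem_of_calculus_interior_strong[OF assms(3,1) _ assms(2)])
      (use assms(4) in \<open>auto simp: D_def has_real_derivative_iff_has_vector_derivative\<close>)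
  have "((\<lambda>_. l) has_integral (b - a) * l) {a..b}"
    using has_integral_const_real[of l a b] assms(1) by simp
  from this D have "(b - a) * l \<le> h b - h a"
    by (rule has_integral_le) (use assms(5) in \<open>auto simp: D_def\<close>)
  then show ?thesis
    by (simp add: mult.commute)
qed

text \<open>Filling in the limit closes a half-open branch, so that integration and the intermediate
  value theorem reach the critical point.\<close>

lemma continuous_on_extend_right_end:
  fixes h :: "real \<Rightarrow> real"
  assumes "a < b" "continuous_on {a..<b} h" "(h \<longlongrightarrow> l) (at_left b)"
  shows "continuous_on {a..b} (\<lambda>x. if x < b then h x else l)" (is "continuous_on _ ?h")
  unfolding continuous_on_def
proof
  fix x assume x: "x \<in> {a..b}"
  show "(?h \<longlongrightarrow> ?h x) (at x within {a..b})"
  proof (cases "x < b")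
    case True
    have "continuous_on {a..<b} ?h"
      using assms(2) by (rule continuous_on_eq) simp
    then have "(?h \<longlongrightarrow> ?h x) (at x within {a..<b})"
      using x True by (simp add: continuous_on_def)
    moreover have "at x within {a..<b} = at x within {a..b}"
      by (rule at_within_nhd[of _ "{..<b}"]) (use True in auto)
    ultimately show ?thesis
      by simp
  next
    case False
    then have "x = b"
      using x by simp
    have "(?h \<longlongrightarrow> l) (at_left b)"
      using assms(3) by (rule Lim_transform_eventually) (auto simp: eventually_at_filter)
    then show ?thesis
      using \<open>x = b\<close> assms(1) by (simp add: at_within_Icc_at_left)
  qed
qed

lemma continuous_on_extend_left_end:
  fixes h :: "real \<Rightarrow> real"
  assumes "a < b" "continuous_on {a<..b} h" "(h \<longlongrightarrow> l) (at_right a)"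
  shows "continuous_on {a..b} (\<lambda>x. if a < x then h x else l)" (is "continuous_on _ ?h")
  unfolding continuous_on_def
proof
  fix x assume x: "x \<in> {a..b}"
  show "(?h \<longlongrightarrow> ?h x) (at x within {a..b})"
  proof (cases "a < x")
    case True
    have "continuous_on {a<..b} ?h"
      using assms(2) by (rule continuous_on_eq) simp
    then have "(?h \<longlongrightarrow> ?h x) (at x within {a<..b})"
      using x True by (simp add: continuous_on_def)
    moreover have "at x within {a<..b} = at x within {a..b}"
      by (rule at_within_nhd[of _ "{a<..}"]) (use True in auto)
    ultimately show ?thesis
      by simp
  next
    case False
    then have "x = a"
      using x by simp
    have "(?h \<longlongrightarrow> l) (at_right a)"
      using assms(3) by (rule Lim_transform_eventually) (auto simp: eventually_at_filter)
    then show ?thesis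
      using \<open>x = a\<close> assms(1) by (simp add: at_within_Icc_at_right)
  qed
qed

section \<open>The two branches of the real map, closed up at the critical point\<close>

locale expanding_Lorenz =
  fixes f :: "real \<Rightarrow> real" and c :: real
  assumes Lorenz: "expanding_Lorenz_map f c"
begin

abbreviation "A \<equiv> preimages_crit f c"
abbreviation "X \<equiv> doubled_space f c"
abbreviation "g \<equiv> Lorenz_ext f c"

lemma c_bounds: "0 < c" "c < 1"
  and f_maps: "0 \<le> x \<Longrightarrow> x \<le> 1 \<Longrightarrow> 0 \<le> f x \<and> f x \<le> 1"
  using Lorenz unfolding expanding_Lorenz_map_def image_subset_iff by auto

text \<open>The values at \<open>c\<close> are the one-sided limits instead of \<open>f c\<close>;
  they are also the base points of the images of \<open>Lft c\<close> and
  \<open>Rgt c\<close>.\<close>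

definition "f_left x = (if x < c then f x else 1)"
definition "f_right x = (if c < x then f x else 0)"

lemma continuous_f_left: "continuous_on {0..c} f_left"
  and continuous_f_right: "continuous_on {c..1} f_right"
  unfolding f_left_def[abs_def] f_right_def[abs_def]
  using Lorenz unfolding expanding_Lorenz_map_def
  by (auto intro: continuous_on_extend_right_end continuous_on_extend_left_end)

lemma expanding_branches:
  obtains l where "1 < l"
    "\<And>x y. \<lbrakk>0 \<le> x; x \<le> y; y \<le> c\<rbrakk> \<Longrightarrow> l * (y - x) \<le> f_left y - f_left x"
    "\<And>x y. \<lbrakk>c \<le> x; x \<le> y; y \<le> 1\<rbrakk> \<Longrightarrow> l * (y - x) \<le> f_right y - f_right x"
proof -
  obtain F f' where F: "finite F"
    and f': "\<And>x. x \<in> {0..1} - F \<Longrightarrow> (f has_real_derivative f' x) (at x within {0..1})"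
    and inf: "1 < (INF x\<in>{0..1} - F. ereal (f' x))"
    using Lorenz unfolding expanding_Lorenz_map_def by blast
  \<comment> \<open>A real rate is inserted strictly between 1 and the infimum, which is an extended
    real; it serves both branches.\<close>
  obtain l where l: "1 < ereal l" "ereal l < (INF x\<in>{0..1} - F. ereal (f' x))"
    using ereal_dense2[OF inf] by blast
  have ge: "l \<le> f' x" if "x \<in> {0..1} - F" for x
    using less_le_trans[OF l(2) INF_lower[OF that]] by simp
  have deriv: "(f has_real_derivative f' x) (at x)" if "0 < x" "x < 1" "x \<notin> F" for x
    using f'[of x] that by (simp add: at_within_Icc_at)
  show thesis
  proof
    show "1 < l"
      using l(1) by simp
    show "l * (y - x) \<le> f_left y - f_left x" if xy: "0 \<le> x" "x \<le> y" "y \<le> c" for x y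
    proof (rule expanding_of_derivative_ge[OF xy(2) _ F])
      show "continuous_on {x..y} f_left"
        by (rule continuous_on_subset[OF continuous_f_left]) (use xy in auto)
      fix z assume z: "z \<in> {x<..<y} - F"
      show "(f_left has_real_derivative f' z) (at z)"
        by (rule has_field_derivative_transform_within_open[OF deriv, of _ "{..<c}"])
          (use z xy c_bounds in \<open>auto simp: f_left_def\<close>)
      show "l \<le> f' z"
        by (rule ge) (use z xy c_bounds in auto)
    qed
    show "l * (y - x) \<le> f_right y - f_right x" if xy: "c \<le> x" "x \<le> y" "y \<le> 1" for x y
    proof (rule expanding_of_derivative_ge[OF xy(2) _ F])
      show "continuous_on {x..y} f_right"
        by (rule continuous_on_subset[OF continuous_f_right]) (use xy in auto)
      fix z assume z: "z \<in> {x<..<y} - F"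
      show "(f_right has_real_derivative f' z) (at z)"
        by (rule has_field_derivative_transform_within_open[OF deriv, of _ "{c<..}"])
          (use z xy c_bounds in \<open>auto simp: f_right_def\<close>)
      show "l \<le> f' z"
        by (rule ge) (use z xy c_bounds in auto)
    qed
  qed
qed

lemma f_left_less: "\<lbrakk>0 \<le> x; x < y; y \<le> c\<rbrakk> \<Longrightarrow> f_left x < f_left y"
  and f_right_less: "\<lbrakk>c \<le> x; x < y; y \<le> 1\<rbrakk> \<Longrightarrow> f_right x < f_right y"
proof -
  obtain l where l: "1 < l"
    "\<And>x y. \<lbrakk>0 \<le> x; x \<le> y; y \<le> c\<rbrakk> \<Longrightarrow> l * (y - x) \<le> f_left y - f_left x"
    "\<And>x y. \<lbrakk>c \<le> x; x \<le> y; y \<le> 1\<rbrakk> \<Longrightarrow> l * (y - x) \<le> f_right y - f_right x"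
    by (rule expanding_branches) blast
  have pos: "0 < l * (y - x)" if "x < y" for x y
    using that l(1) by simp
  show "\<lbrakk>0 \<le> x; x < y; y \<le> c\<rbrakk> \<Longrightarrow> f_left x < f_left y"
    using l(2)[of x y] pos[of x y] by simp
  show "\<lbrakk>c \<le> x; x < y; y \<le> 1\<rbrakk> \<Longrightarrow> f_right x < f_right y"
    using l(3)[of x y] pos[of x y] by simp
qed

lemma f_left_ends: "f_left 0 = f 0" "f_left c = 1"
  and f_right_ends: "f_right c = 0" "f_right 1 = f 1"
  using c_bounds by (auto simp: f_left_def f_right_def)

lemma f_left_surj: "\<lbrakk>f 0 \<le> y; y \<le> 1\<rbrakk> \<Longrightarrow> \<exists>x\<ge>0. x \<le> c \<and> f_left x = y"
  using IVT'[of f_left 0 y c] continuous_f_left c_bounds by (auto simp: f_left_ends)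

lemma f_right_surj: "\<lbrakk>0 \<le> y; y \<le> f 1\<rbrakk> \<Longrightarrow> \<exists>x\<ge>c. x \<le> 1 \<and> f_right x = y"
  using IVT'[of f_right c y 1] continuous_f_right c_bounds by (auto simp: f_right_ends)

text \<open>By strict growth the value lies strictly between the values of the branch at its two
  ends, which are in \<open>[0, 1]\<close>.\<close>

lemma f_interior: "\<lbrakk>0 < x; x < 1; x \<noteq> c\<rbrakk> \<Longrightarrow> 0 < f x \<and> f x < 1"
  using f_left_less[of 0 x] f_left_less[of x c] f_right_less[of c x] f_right_less[of x 1]
    c_bounds f_maps[of 0] f_maps[of 1]
  by (cases "x < c") (auto simp: f_left_def f_right_def)

section \<open>The doubled space\<close>

lemma crit_range: "a \<in> A \<Longrightarrow> 0 < a \<and> a < 1"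
  by (auto simp: preimages_crit_def less_le)

lemma c_crit: "c \<in> A"
  using c_bounds by (auto simp: preimages_crit_def intro!: exI[of _ 0])

text \<open>As \<open>x \<noteq> c\<close>, a visit to \<open>c\<close> from \<open>x\<close> is a
  visit from \<open>f x\<close> one step earlier, and \<open>f_interior\<close> keeps
  \<open>f x\<close> away from the ends removed from \<open>A\<close>. Hence doubled points go to
  doubled points and single points to single ones.\<close>

lemma f_crit_iff: "\<lbrakk>0 < x; x < 1; x \<noteq> c\<rbrakk> \<Longrightarrow> f x \<in> A \<longleftrightarrow> x \<in> A"
proof -
  assume x: "0 < x" "x < 1" "x \<noteq> c"
  have "(\<exists>n. (f ^^ n) x = c) \<longleftrightarrow> (\<exists>n. (f ^^ n) (f x) = c)"
  proof
    assume "\<exists>n. (f ^^ n) x = c"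
    then obtain n where n: "(f ^^ n) x = c"
      by blast
    then show "\<exists>n. (f ^^ n) (f x) = c"
      using x(3) by (cases n) (auto simp del: funpow.simps simp: funpow_Suc_right)
  next
    assume "\<exists>n. (f ^^ n) (f x) = c"
    then show "\<exists>n. (f ^^ n) x = c"
      by (metis comp_apply funpow_Suc_right)
  qed
  then show ?thesis
    using x f_interior[OF x] by (auto simp: preimages_crit_def)
qed

lemma mem_X [simp]:
  "Pt x \<in> X \<longleftrightarrow> 0 \<le> x \<and> x \<le> 1 \<and> x \<notin> A" "Lft x \<in> X \<longleftrightarrow> x \<in> A" "Rgt x \<in> X \<longleftrightarrow> x \<in> A"
  by (auto simp: doubled_space_def)

lemma ends_not_crit [simp]: "0 \<notin> A" "1 \<notin> A"
  by (auto simp: preimages_crit_def)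

lemma base_range: "x \<in> X \<Longrightarrow> 0 \<le> base x \<and> base x \<le> 1"
  by (cases x) (auto dest: crit_range)

text \<open>Over a base point there is either a single \<open>Pt\<close> or a pair of copies, never
  both.\<close>

lemma X_less_cases:
  assumes "x \<in> X" "y \<in> X" "x < y"
  obtains "base x < base y" | a where "a \<in> A" "x = Lft a" "y = Rgt a"
  using assms by (cases x; cases y) (auto simp: less_dpoint_def)

lemma left_le: "x \<in> X \<Longrightarrow> x \<le> Lft c \<Longrightarrow> 0 \<le> base x \<and> base x \<le> c"
  by (cases x) (auto simp: less_eq_dpoint_def less_dpoint_def dest: crit_range)

lemma right_ge: "x \<in> X \<Longrightarrow> Rgt c \<le> x \<Longrightarrow> c \<le> base x \<and> base x \<le> 1"
  by (cases x) (auto simp: less_eq_dpoint_def less_dpoint_def dest: crit_range)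

lemma base_g_left: "x \<in> X \<Longrightarrow> x \<le> Lft c \<Longrightarrow> base (g x) = f_left (base x)"
  by (cases x) (auto simp: less_eq_dpoint_def less_dpoint_def f_left_def dest: crit_range)

lemma base_g_right: "x \<in> X \<Longrightarrow> Rgt c \<le> x \<Longrightarrow> base (g x) = f_right (base x)"
  using c_bounds
  by (cases x) (auto simp: less_eq_dpoint_def less_dpoint_def f_right_def dest: crit_range)

section \<open>The extended map on the two halves of the doubled space\<close>

lemma g_closed: "x \<in> X \<Longrightarrow> g x \<in> X"
proof (cases x)
  case (Pt t)
  assume "x \<in> X"
  then show ?thesis
    using Pt c_crit f_maps[of t] f_crit_iff[of t] by (cases "t = 0 \<or> t = 1") auto
next
  case (Lft a)
  assume "x \<in> X"
  then show ?thesis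
    using Lft f_crit_iff[of a] crit_range[of a] by auto
next
  case (Rgt a)
  assume "x \<in> X"
  then show ?thesis
    using Rgt f_crit_iff[of a] crit_range[of a] by auto
qed

lemma X_jump: "x \<in> X \<Longrightarrow> x \<le> Lft c \<or> Rgt c \<le> x"
  using c_crit
  by (cases x; cases "base x" c rule: linorder_cases) (auto simp: less_eq_dpoint_def less_dpoint_def)

lemma g_mono_left:
  assumes "x \<in> X" "y \<in> X" "x < y" "y \<le> Lft c"
  shows "g x < g y"
  using assms(1-3)
proof (cases rule: X_less_cases)
  case 1
  have "x \<le> Lft c"
    using assms(3,4) by order
  then show ?thesis
    using 1 f_left_less[of "base x" "base y"] left_le[of x] left_le[of y] base_g_left assms
    by (simp add: less_dpoint_def)
next
  case (2 a)
  \<comment> \<open>\<open>Rgt c\<close> is not below \<open>Lft c\<close>, so the pair of copies is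
    not the one that bounds the gap.\<close>
  then have "a \<noteq> c"
    using assms(4) by (auto simp: less_eq_dpoint_def less_dpoint_def)
  then show ?thesis
    using 2 by (simp add: less_dpoint_def)
qed

lemma g_mono_right:
  assumes "x \<in> X" "y \<in> X" "x < y" "Rgt c \<le> x"
  shows "g x < g y"
  using assms(1-3)
proof (cases rule: X_less_cases)
  case 1
  have "Rgt c \<le> y"
    using assms(3,4) by order
  then show ?thesis
    using 1 f_right_less[of "base x" "base y"] right_ge[of x] right_ge[of y] base_g_right assms
    by (simp add: less_dpoint_def)
next
  case (2 a)
  then have "a \<noteq> c"
    using assms(4) by (auto simp: less_eq_dpoint_def less_dpoint_def)
  then show ?thesis
    using 2 by (simp add: less_dpoint_def)
qed

lemma X_bounds: "x \<in> X \<Longrightarrow> Pt 0 \<le> x" "x \<in> X \<Longrightarrow> x \<le> Pt 1"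
  by (cases x; force simp: less_eq_dpoint_def less_dpoint_def dest: crit_range)+

text \<open>The closed branch \<open>f_left\<close> takes the value \<open>base y\<close> at some
  \<open>t\<close>; it remains to find a point over \<open>t\<close> that is sent to
  \<open>y\<close> with the correct side.\<close>

lemma g_image_left: "g ` {x \<in> X. x \<le> Lft c} = {y \<in> X. g (Pt 0) \<le> y}"
proof (intro equalityI subsetI)
  fix y assume "y \<in> g ` {x \<in> X. x \<le> Lft c}"
  then obtain x where x: "x \<in> X" "x \<le> Lft c" "y = g x"
    by blast
  then have "g (Pt 0) \<le> g x"
    using g_mono_left[of "Pt 0" x] X_bounds(1)[of x]
    by (cases "x = Pt 0") (auto simp del: Lorenz_ext.simps intro: less_imp_le)
  then show "y \<in> {y \<in> X. g (Pt 0) \<le> y}"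
    using x g_closed by simp
next
  fix y assume "y \<in> {y \<in> X. g (Pt 0) \<le> y}"
  then have y: "y \<in> X" "g (Pt 0) \<le> y"
    by auto
  have "base (g (Pt 0)) = f 0"
    by simp
  then have "f 0 \<le> base y"
    using y(2) by (auto simp: less_eq_dpoint_def less_dpoint_def)
  then obtain t where t: "0 \<le> t" "t \<le> c" "f_left t = base y"
    using f_left_surj[of "base y"] base_range[OF y(1)] by blast
  consider "t = 0" | "t = c" | "0 < t" "t < c"
    using t by linarith
  then have "\<exists>x\<in>X. x \<le> Lft c \<and> g x = y"
  proof cases
    case 1
    then have "base y = f 0"
      using t f_left_ends by simp
    \<comment> \<open>If \<open>f 0\<close> is doubled, \<open>g (Pt 0)\<close> is its right copy,
      and \<open>g (Pt 0) \<le> y\<close> rules out the left one.\<close>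
    then have "y = g (Pt 0)"
      using y by (cases y) (auto simp: less_eq_dpoint_def less_dpoint_def split: if_splits)
    then show ?thesis
      using c_bounds by (intro bexI[of _ "Pt 0"]) (auto simp: less_eq_dpoint_def less_dpoint_def)
  next
    case 2
    then have "y = Pt 1"
      using t f_left_ends y by (cases y) auto
    then show ?thesis
      using c_crit by (intro bexI[of _ "Lft c"]) auto
  next
    case 3
    then have "f t = base y" and "f t \<in> A \<longleftrightarrow> t \<in> A"
      using t f_crit_iff[of t] c_bounds by (auto simp: f_left_def)
    \<comment> \<open>The witness is the point over \<open>t\<close> on the same side as
      \<open>y\<close>; it lies in \<open>X\<close> because \<open>t\<close> is doubled exactly when
      \<open>base y\<close> is.\<close>
    then show ?thesis
      using 3 y(1) c_bounds
      by (intro bexI[of _ "case y of Lft _ \<Rightarrow> Lft t | Pt _ \<Rightarrow> Pt t | Rgt _ \<Rightarrow> Rgt t"])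
        (auto simp: less_eq_dpoint_def less_dpoint_def split: dpoint.split)
  qed
  then show "y \<in> g ` {x \<in> X. x \<le> Lft c}"
    by blast
qed

lemma g_image_right: "g ` {x \<in> X. Rgt c \<le> x} = {y \<in> X. y \<le> g (Pt 1)}"
proof (intro equalityI subsetI)
  fix y assume "y \<in> g ` {x \<in> X. Rgt c \<le> x}"
  then obtain x where x: "x \<in> X" "Rgt c \<le> x" "y = g x"
    by blast
  then have "g x \<le> g (Pt 1)"
    using g_mono_right[of x "Pt 1"] X_bounds(2)[of x]
    by (cases "x = Pt 1") (auto simp del: Lorenz_ext.simps intro: less_imp_le)
  then show "y \<in> {y \<in> X. y \<le> g (Pt 1)}"
    using x g_closed by simp
next
  fix y assume "y \<in> {y \<in> X. y \<le> g (Pt 1)}"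
  then have y: "y \<in> X" "y \<le> g (Pt 1)"
    by auto
  have "base (g (Pt 1)) = f 1"
    by simp
  then have "base y \<le> f 1"
    using y(2) by (auto simp: less_eq_dpoint_def less_dpoint_def)
  then obtain t where t: "c \<le> t" "t \<le> 1" "f_right t = base y"
    using f_right_surj[of "base y"] base_range[OF y(1)] by blast
  consider "t = 1" | "t = c" | "c < t" "t < 1"
    using t by linarith
  then have "\<exists>x\<in>X. Rgt c \<le> x \<and> g x = y"
  proof cases
    case 1
    then have "base y = f 1"
      using t f_right_ends by simp
    then have "y = g (Pt 1)"
      using y by (cases y) (auto simp: less_eq_dpoint_def less_dpoint_def split: if_splits)
    then show ?thesis
      using c_bounds by (intro bexI[of _ "Pt 1"]) (auto simp: less_eq_dpoint_def less_dpoint_def)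
  next
    case 2
    then have "y = Pt 0"
      using t f_right_ends y by (cases y) auto
    then show ?thesis
      using c_crit by (intro bexI[of _ "Rgt c"]) auto
  next
    case 3
    then have "f t = base y" and "f t \<in> A \<longleftrightarrow> t \<in> A"
      using t f_crit_iff[of t] c_bounds by (auto simp: f_right_def)
    then show ?thesis
      using 3 y(1) c_bounds
      by (intro bexI[of _ "case y of Lft _ \<Rightarrow> Lft t | Pt _ \<Rightarrow> Pt t | Rgt _ \<Rightarrow> Rgt t"])
        (auto simp: less_eq_dpoint_def less_dpoint_def split: dpoint.split)
  qed
  then show "y \<in> g ` {x \<in> X. Rgt c \<le> x}"
    by blast
qed

text \<open>The supremum \<open>r\<close> of the base points fixes the least upper bound up to its
  side: it is \<open>Rgt r\<close> if that point is in \<open>S\<close>, otherwise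
  \<open>Lft r\<close> if \<open>r\<close> is doubled and \<open>Pt r\<close> if not.\<close>

lemma X_complete:
  assumes "S \<subseteq> X" "S \<noteq> {}"
  shows "\<exists>s\<in>X. (\<forall>t\<in>S. t \<le> s) \<and> (\<forall>u\<in>X. (\<forall>t\<in>S. t \<le> u) \<longrightarrow> s \<le> u)"
proof -
  define r where "r = Sup (base ` S)"
  have bdd: "bdd_above (base ` S)"
    using assms(1) base_range by (intro bdd_aboveI[of _ 1]) auto
  have upper: "base t \<le> r" if "t \<in> S" for t
    unfolding r_def using that bdd by (auto intro: cSup_upper)
  have least: "r \<le> base u" if "\<forall>t\<in>S. t \<le> u" for u
    unfolding r_def using that assms(2)
    by (intro cSup_least) (auto simp: less_eq_dpoint_def less_dpoint_def)
  have r: "0 \<le> r" "r \<le> 1"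
  proof -
    obtain t where "t \<in> S"
      using assms(2) by blast
    then show "0 \<le> r"
      using upper[of t] base_range[of t] assms(1) by force
    show "r \<le> 1"
      using least[of "Pt 1"] X_bounds(2) assms(1) by auto
  qed
  consider "Rgt r \<in> S" | "r \<in> A" "Rgt r \<notin> S" | "r \<notin> A"
    by blast
  then show ?thesis
  proof cases
    case 1
    have "t \<le> Rgt r" if "t \<in> S" for t
      using upper[OF that] by (cases t) (auto simp: less_eq_dpoint_def less_dpoint_def)
    then show ?thesis
      using 1 assms(1) by blast
  next
    case 2
    have "t \<le> Lft r" if "t \<in> S" for t
    proof -
      have "t \<noteq> Rgt r" "t \<in> X"
        using that 2(2) assms(1) by auto
      then show ?thesis
        using upper[OF that] 2(1)
          by (cases t; cases "base t" r rule: linorder_cases) (auto simp: less_eq_dpoint_def less_dpoint_def)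
    qed
    moreover have "Lft r \<le> u" if "\<forall>t\<in>S. t \<le> u" for u
      using least[OF that] by (cases u) (auto simp: less_eq_dpoint_def less_dpoint_def)
    ultimately show ?thesis
      using 2(1) by (intro bexI[of _ "Lft r"]) auto
  next
    case 3
    have "t \<le> Pt r" if "t \<in> S" for t
    proof -
      have "t \<in> X"
        using that assms(1) by auto
      then show ?thesis
        using upper[OF that] 3
          by (cases t; cases "base t" r rule: linorder_cases) (auto simp: less_eq_dpoint_def less_dpoint_def)
    qed
    moreover have "Pt r \<le> u" if "u \<in> X" "\<forall>t\<in>S. t \<le> u" for u
      using least[OF that(2)] that(1) 3
      by (cases u; cases "base u" r rule: linorder_cases) (auto simp: less_eq_dpoint_def less_dpoint_def)
    ultimately show ?thesis
      using 3 r by (intro bexI[of _ "Pt r"]) auto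
  qed
qed

text \<open>The two copies of \<open>a\<close> move to the two copies of \<open>f a\<close> until
  the base point is \<open>c\<close>; there they lie on opposite sides of the gap.\<close>

lemma doubled_point_separates:
  "\<lbrakk>a \<in> A; (f ^^ n) a = c\<rbrakk> \<Longrightarrow> \<exists>k. (g ^^ k) (Lft a) \<le> Lft c \<and> \<not> (g ^^ k) (Rgt a) \<le> Lft c"
proof (induction n arbitrary: a)
  case 0
  then show ?case
    by (intro exI[of _ 0]) (auto simp: less_eq_dpoint_def less_dpoint_def)
next
  case (Suc n)
  show ?case
  proof (cases "a = c")
    \<comment> \<open>A visit to \<open>c\<close> before time \<open>n\<close> ends the induction at
      once, since beyond \<open>c\<close> the copies no longer follow \<open>f\<close>.\<close>
    case True
    then show ?thesis
      by (intro exI[of _ 0]) (auto simp: less_eq_dpoint_def less_dpoint_def)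
  next
    case False
    have "f a \<in> A"
      using f_crit_iff[of a] crit_range[of a] Suc.prems(1) False by simp
    moreover have "(f ^^ n) (f a) = c"
      using Suc.prems(2) by (metis comp_apply funpow_Suc_right)
    ultimately obtain k where
      "(g ^^ k) (Lft (f a)) \<le> Lft c \<and> \<not> (g ^^ k) (Rgt (f a)) \<le> Lft c"
      using Suc.IH by blast
    then have "(g ^^ Suc k) (Lft a) \<le> Lft c \<and> \<not> (g ^^ Suc k) (Rgt a) \<le> Lft c"
      using False unfolding funpow_Suc_right by simp
    then show ?thesis
      by blast
  qed
qed

text \<open>Two points with the same itinerary have the same base point, because distances between base
  points would otherwise grow geometrically; the two copies of a doubled point are separated when
  they reach \<open>c\<close>.\<close>

lemma same_itinerary_not_less:
  assumes xy: "x \<in> X" "y \<in> X" and same: "\<And>n. (g ^^ n) x \<le> Lft c \<longleftrightarrow> (g ^^ n) y \<le> Lft c"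
  shows "\<not> x < y"
proof
  assume "x < y"
  obtain l where l: "1 < l"
    "\<And>x y. \<lbrakk>0 \<le> x; x \<le> y; y \<le> c\<rbrakk> \<Longrightarrow> l * (y - x) \<le> f_left y - f_left x"
    "\<And>x y. \<lbrakk>c \<le> x; x \<le> y; y \<le> 1\<rbrakk> \<Longrightarrow> l * (y - x) \<le> f_right y - f_right x"
    by (rule expanding_branches) blast
  have mem: "(g ^^ n) z \<in> X" if "z \<in> X" for n z
    using that by (induction n) (auto intro: g_closed)
  \<comment> \<open>At every time both points lie in the same branch, where \<open>g\<close> is
    increasing.\<close>
  have less: "(g ^^ n) x < (g ^^ n) y" for n
  proof (induction n)
    case (Suc n)
    then show ?case
      using g_mono_left[OF mem mem] g_mono_right[OF mem mem] xy same[of n] X_jump[OF mem]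
      by (metis comp_apply funpow.simps(2))
  qed (use \<open>x < y\<close> in simp)
  have grow: "l ^ n * (base y - base x) \<le> base ((g ^^ n) y) - base ((g ^^ n) x)" for n
  proof (induction n)
    case (Suc n)
    define u v where "u = (g ^^ n) x" and "v = (g ^^ n) y"
    have uv: "u \<in> X" "v \<in> X" "base u \<le> base v"
      using mem xy less[of n] by (auto simp: u_def v_def less_dpoint_def)
    have "l * (base v - base u) \<le> base (g v) - base (g u)"
    proof (cases "v \<le> Lft c")
      case True
      then have "u \<le> Lft c"
        using same[of n] by (simp add: u_def v_def)
      then show ?thesis
        using True uv base_g_left left_le l(2) by simp
    next
      case False
      then have "\<not> u \<le> Lft c"
        using same[of n] by (simp add: u_def v_def)
      then have "Rgt c \<le> u" "Rgt c \<le> v"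
        using X_jump uv False by blast+
      then show ?thesis
        using uv base_g_right right_ge l(3) by simp
    qed
    moreover have "l ^ Suc n * (base y - base x) \<le> l * (base v - base u)"
      using Suc l(1) by (simp add: u_def v_def mult.assoc)
    ultimately show ?case
      by (simp add: u_def v_def)
  qed simp
  from xy \<open>x < y\<close> show False
  proof (cases rule: X_less_cases)
    case 1
    \<comment> \<open>At this time the distance of the base points would exceed the length 1 of the
      interval.\<close>
    obtain n where "1 / (base y - base x) < l ^ n"
      using real_arch_pow[OF l(1)] by blast
    then have "1 < l ^ n * (base y - base x)"
      using 1 by (simp add: field_simps)
    moreover have "base ((g ^^ n) y) - base ((g ^^ n) x) \<le> 1"
      using base_range[OF mem[OF xy(1), of n]] base_range[OF mem[OF xy(2), of n]] by linarith
    ultimately show ?thesis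
      using grow[of n] by linarith
  next
    case (2 a)
    then obtain n where "(f ^^ n) a = c"
      by (auto simp: preimages_crit_def)
    then show ?thesis
      using doubled_point_separates[OF 2(1)] same 2 by blast
  qed
qed

section \<open>Transfer of the order-theoretic results to the doubled space\<close>

sublocale order_Lorenz X g "Pt 0" "Pt 1" "Lft c" "Rgt c"
proof
  show "Pt 0 \<in> X" "Pt 1 \<in> X" "Lft c \<in> X" "Rgt c \<in> X"
    using c_crit by simp_all
  show "Lft c < Rgt c"
    by (simp add: less_dpoint_def)
  show "x = y" if "x \<in> X" "y \<in> X" "\<And>n. (g ^^ n) x \<le> Lft c \<longleftrightarrow> (g ^^ n) y \<le> Lft c" for x y
    using same_itinerary_not_less[of x y] same_itinerary_not_less[of y x] that
    by (cases x y rule: linorder_cases) simp_all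
qed (fact X_bounds X_jump g_mono_left g_mono_right g_image_left g_image_right X_complete)+

text \<open>The union of all preimages of an orbit contains the image and every preimage of each of
  its points, so both closure lemmas apply to it.\<close>

lemma backward_closure_invariant:
  assumes "periodic_orbit X g k Orb"
  shows "g ` backward_closure f c Orb \<subseteq> backward_closure f c Orb"
    and "{x \<in> X. g x \<in> backward_closure f c Orb} - backward_closure f c Orb \<subseteq> {Pt 0, Pt 1}"
proof -
  define S where "S = (\<Union>n. {x \<in> X. (g ^^ n) x \<in> Orb})"
  have eq: "backward_closure f c Orb = T closure_of S"
    by (simp add: backward_closure_def S_def)
  have Orb: "g x \<in> Orb" if "x \<in> Orb" for x
    using assms that orbit.step by (force simp: periodic_orbit_def)
  have "g ` S \<subseteq> S"
  proof (clarsimp simp: S_def)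
    fix x n assume x: "x \<in> X" "(g ^^ n) x \<in> Orb"
    have "(g ^^ n) (g x) \<in> Orb"
      using Orb[OF x(2)] by (simp add: funpow_swap1)
    then show "g x \<in> X \<and> (\<exists>n. (g ^^ n) (g x) \<in> Orb)"
      using g_closed x(1) by blast
  qed
  then show "g ` backward_closure f c Orb \<subseteq> backward_closure f c Orb"
    unfolding eq by (rule closure_forward_invariant)
  have "x \<in> S" if x: "x \<in> X" "g x \<in> S" for x
  proof -
    obtain n where "(g ^^ n) (g x) \<in> Orb"
      using x(2) by (auto simp: S_def)
    then have "(g ^^ Suc n) x \<in> Orb"
      by (simp add: funpow_swap1)
    then show ?thesis
      using x(1) unfolding S_def by blast
  qed
  then show "{x \<in> X. g x \<in> backward_closure f c Orb} - backward_closure f c Orb \<subseteq> {Pt 0, Pt 1}"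
    unfolding eq by (rule closure_backward_invariant)
qed

end

theorem theorem4p5:
  fixes f :: "real \<Rightarrow> real" and c :: real and \<kappa> :: nat and Orb :: "dpoint set"
  assumes "expanding_Lorenz_map f c"
    and "smallest_period (doubled_space f c) (Lorenz_ext f c) = enat \<kappa>"
    and "1 < \<kappa>"
    and "periodic_orbit (doubled_space f c) (Lorenz_ext f c) \<kappa> Orb"
  shows "Lorenz_ext f c ` backward_closure f c Orb \<subseteq> backward_closure f c Orb \<and>
         {x \<in> doubled_space f c. Lorenz_ext f c x \<in> backward_closure f c Orb}
           - backward_closure f c Orb \<subseteq> {Pt 0, Pt 1} \<and>
         (\<forall>Orb'. periodic_orbit (doubled_space f c) (Lorenz_ext f c) \<kappa> Orb' \<longrightarrow> Orb' = Orb)"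
proof -
  interpret expanding_Lorenz f c
    by unfold_locales (rule assms(1))
  show ?thesis
    using backward_closure_invariant[OF assms(4)] unique_periodic_orbit[OF assms(2-4)] by blast
qed

end
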